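(* There are two elements $s_1,s_2\in S_{A_0(4)}$ such that $s_1\neq s_2$, but $\alpha(s_1)=\alpha(s_2)\in Br_4$.
   Context: $Br_4$ is the braid group on $4$ strings with standard generators $a_1,a_2,a_3$ ($a_1a_2a_1=a_2a_1a_2$, $a_2a_3a_2=a_3a_2a_3$, $a_1a_3=a_3a_1$). $A_0(4)\subset Br_4$ is the set of all conjugates of $a_1$ in $Br_4$ (equivalently, all conjugates of the standard generators). $S_{A_0(4)}=S(Br_4,A_0(4))$ is the factorization semigroup: the quotient of the free semigroup of words $x_1\cdot x_2\cdot\ldots\cdot x_n$ with letters $x_i\in A_0(4)$ by the relations $x\cdot y=y\cdot(y^{-1}xy)$ and $x\cdot y=(xyx^{-1})\cdot x$ for $x,y\in A_0(4)$ (Hurwitz moves). $\alpha:S_{A_0(4)}\to Br_4$ is the product homomorphism, $\alpha(x_1\cdot\ldots\cdot x_n)=x_1\cdots x_n$. *)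

theory Defs
  imports "HOL-Algebra.Group"
begin

section \<open>Quotients of free monoids\<close>

text \<open>The congruence on the free monoid \<open>lists X\<close> generated by the pairs of words \<open>R\<close>.\<close>

inductive_set word_cong :: "'a set \<Rightarrow> ('a list \<times> 'a list) set \<Rightarrow> ('a list \<times> 'a list) set"
  for X :: "'a set" and R :: "('a list \<times> 'a list) set" where
  base: "(u, v) \<in> R \<Longrightarrow> u \<in> lists X \<Longrightarrow> v \<in> lists X \<Longrightarrow> (u, v) \<in> word_cong X R"
| refl: "u \<in> lists X \<Longrightarrow> (u, u) \<in> word_cong X R"
| sym: "(u, v) \<in> word_cong X R \<Longrightarrow> (v, u) \<in> word_cong X R"
| trans: "(u, v) \<in> word_cong X R \<Longrightarrow> (v, w) \<in> word_cong X R \<Longrightarrow> (u, w) \<in> word_cong X R"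
| append: "(u, v) \<in> word_cong X R \<Longrightarrow> (u', v') \<in> word_cong X R
    \<Longrightarrow> (u @ u', v @ v') \<in> word_cong X R"

definition word_class_mult ::
  "'a set \<Rightarrow> ('a list \<times> 'a list) set \<Rightarrow> 'a list set \<Rightarrow> 'a list set \<Rightarrow> 'a list set" where
  "word_class_mult X R A B = (\<Union>u\<in>A. \<Union>v\<in>B. word_cong X R `` {u @ v})"

lemma word_cong_lists: "(u, v) \<in> word_cong X R \<Longrightarrow> u \<in> lists X \<and> v \<in> lists X"
  by (induction rule: word_cong.induct) auto

lemma equiv_word_cong: "equiv (lists X) (word_cong X R)"
proof (rule equivI)
  show "word_cong X R \<subseteq> lists X \<times> lists X"
    using word_cong_lists by fast
  show "refl_on (lists X) (word_cong X R)"
    by (rule refl_onI) (rule word_cong.refl)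
  show "sym (word_cong X R)"
    by (rule symI) (rule word_cong.sym)
  show "trans (word_cong X R)"
    by (rule transI) (rule word_cong.trans)
qed

lemma word_class_eqI: "(u, v) \<in> word_cong X R \<Longrightarrow> word_cong X R `` {u} = word_cong X R `` {v}"
  by (rule equiv_class_eq[OF equiv_word_cong])

lemma word_class_mult_class:
  assumes "u \<in> lists X" "v \<in> lists X"
  shows "word_class_mult X R (word_cong X R `` {u}) (word_cong X R `` {v})
    = word_cong X R `` {u @ v}"
proof -
  have "word_cong X R `` {u' @ v'} = word_cong X R `` {u @ v}"
    if "(u, u') \<in> word_cong X R" "(v, v') \<in> word_cong X R" for u' v'
    using word_class_eqI[OF word_cong.append[OF that]] by simp
  moreover have "(u, u) \<in> word_cong X R" "(v, v) \<in> word_cong X R"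
    using assms by (auto intro: word_cong.refl)
  ultimately show ?thesis
    unfolding word_class_mult_def by blast
qed

section \<open>Groups given by generators and relations\<close>

text \<open>The letter \<open>(x, True)\<close> stands for the generator \<open>x\<close> and \<open>(x, False)\<close> for its inverse.\<close>

definition presentation_rels ::
  "'a set \<Rightarrow> (('a \<times> bool) list \<times> ('a \<times> bool) list) set \<Rightarrow> (('a \<times> bool) list \<times> ('a \<times> bool) list) set"
where
  "presentation_rels X R = {([(x, b), (x, \<not> b)], []) | x b. x \<in> X} \<union> R"

definition presented_group ::
  "'a set \<Rightarrow> (('a \<times> bool) list \<times> ('a \<times> bool) list) set \<Rightarrow> ('a \<times> bool) list set monoid" where
  "presented_group X R =
    \<lparr>carrier = lists (X \<times> UNIV) // word_cong (X \<times> UNIV) (presentation_rels X R),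
     mult = word_class_mult (X \<times> UNIV) (presentation_rels X R),
     one = word_cong (X \<times> UNIV) (presentation_rels X R) `` {[]}\<rparr>"

lemma group_presented_group: "group (presented_group X R)"
proof -
  let ?L = "lists (X \<times> (UNIV :: bool set))"
  let ?E = "word_cong (X \<times> UNIV) (presentation_rels X R)"
  let ?M = "word_class_mult (X \<times> UNIV) (presentation_rels X R)"
  define iv :: "('a \<times> bool) list \<Rightarrow> ('a \<times> bool) list" where
    "iv w = rev (map (\<lambda>(x, b). (x, \<not> b)) w)" for w
  have ivL: "iv w \<in> ?L" if "w \<in> ?L" for w
    using that by (fastforce simp: iv_def)
  have ivE: "(iv w @ w, []) \<in> ?E" if "w \<in> ?L" for w
    using that
  proof (induction w)
    case Nil
    show ?case by (simp add: iv_def word_cong.refl)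
  next
    case (Cons p w)
    obtain x b where p: "p = (x, b)" by force
    have x: "x \<in> X" and w: "w \<in> ?L" using Cons p by auto
    have "([(x, \<not> b), (x, b)], []) \<in> ?E"
      using x by (intro word_cong.base) (auto simp: presentation_rels_def)
    from word_cong.append[OF this word_cong.refl[OF w]]
    have "((x, \<not> b) # (x, b) # w, w) \<in> ?E" by simp
    from word_cong.append[OF word_cong.refl[OF ivL[OF w]] this]
    have "(iv (p # w) @ p # w, iv w @ w) \<in> ?E"
      by (simp add: iv_def p)
    then show ?case
      using Cons.IH w word_cong.trans by blast
  qed
  show ?thesis
  proof (rule groupI, unfold presented_group_def, simp_all only: partial_object.simps monoid.simps)
    show "?E `` {[]} \<in> ?L // ?E" by (simp add: quotientI)
  next
    fix A B assume "A \<in> ?L // ?E" "B \<in> ?L // ?E"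
    then obtain u v where "u \<in> ?L" "v \<in> ?L" "A = ?E `` {u}" "B = ?E `` {v}"
      by (auto elim!: quotientE)
    moreover have "u @ v \<in> ?L" using calculation by simp
    ultimately show "?M A B \<in> ?L // ?E"
      by (simp only: word_class_mult_class quotientI)
  next
    fix A B C assume "A \<in> ?L // ?E" "B \<in> ?L // ?E" "C \<in> ?L // ?E"
    then obtain u v w where *: "u \<in> ?L" "v \<in> ?L" "w \<in> ?L"
      "A = ?E `` {u}" "B = ?E `` {v}" "C = ?E `` {w}"
      by (auto elim!: quotientE)
    have "u @ v \<in> ?L" "v @ w \<in> ?L" using * by simp_all
    with * show "?M (?M A B) C = ?M A (?M B C)"
      by (simp only: word_class_mult_class append_assoc)
  next
    fix A assume "A \<in> ?L // ?E"
    then obtain u where *: "u \<in> ?L" "A = ?E `` {u}" by (auto elim!: quotientE)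
    have nil: "[] \<in> ?L" by simp
    show "?M (?E `` {[]}) A = A"
      unfolding *(2) word_class_mult_class[OF nil *(1)] by simp
    have "?M (?E `` {iv u}) A = ?E `` {[]}"
      unfolding *(2) word_class_mult_class[OF ivL[OF *(1)] *(1)]
      by (rule word_class_eqI[OF ivE[OF *(1)]])
    then show "\<exists>B\<in>?L // ?E. ?M B A = ?E `` {[]}"
      using quotientI[OF ivL[OF *(1)]] by blast
  qed
qed

section \<open>Braid groups\<close>

definition braid_rels :: "nat \<Rightarrow> ((nat \<times> bool) list \<times> (nat \<times> bool) list) set" where
  "braid_rels n =
    {([(i, True), (i + 1, True), (i, True)], [(i + 1, True), (i, True), (i + 1, True)])
      | i. 1 \<le> i \<and> i + 1 < n} \<union>
    {([(i, True), (j, True)], [(j, True), (i, True)]) | i j. 1 \<le> i \<and> i + 2 \<le> j \<and> j < n}"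

definition braid_group :: "nat \<Rightarrow> (nat \<times> bool) list set monoid" where
  "braid_group n = presented_group {1..<n} (braid_rels n)"

definition braid_gen :: "nat \<Rightarrow> nat \<Rightarrow> (nat \<times> bool) list set" where
  "braid_gen n i =
    word_cong ({1..<n} \<times> UNIV) (presentation_rels {1..<n} (braid_rels n)) `` {[(i, True)]}"

lemma group_braid_group: "group (braid_group n)"
  unfolding braid_group_def by (rule group_presented_group)

lemma braid_gen_closed: "1 \<le> i \<Longrightarrow> i < n \<Longrightarrow> braid_gen n i \<in> carrier (braid_group n)"
  by (auto simp: braid_gen_def braid_group_def presented_group_def intro!: quotientI)

definition conj_class :: "('a, 'b) monoid_scheme \<Rightarrow> 'a \<Rightarrow> 'a set" where
  "conj_class G g = {x \<otimes>\<^bsub>G\<^esub> g \<otimes>\<^bsub>G\<^esub> inv\<^bsub>G\<^esub> x | x. x \<in> carrier G}"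

definition half_twists :: "nat \<Rightarrow> (nat \<times> bool) list set set" where
  "half_twists n = conj_class (braid_group n) (braid_gen n 1)"

section \<open>Factorization semigroups\<close>

text \<open>The set \<open>A\<close> of letters is meant to be a conjugation-invariant subset of the group \<open>G\<close>.
  Elements of the semigroup are classes of nonempty words, since a free semigroup has no unit.\<close>

definition hurwitz_rels :: "('a, 'b) monoid_scheme \<Rightarrow> 'a set \<Rightarrow> ('a list \<times> 'a list) set" where
  "hurwitz_rels G A =
    {([x, y], [y, inv\<^bsub>G\<^esub> y \<otimes>\<^bsub>G\<^esub> x \<otimes>\<^bsub>G\<^esub> y]) | x y. x \<in> A \<and> y \<in> A} \<union>
    {([x, y], [x \<otimes>\<^bsub>G\<^esub> y \<otimes>\<^bsub>G\<^esub> inv\<^bsub>G\<^esub> x, x]) | x y. x \<in> A \<and> y \<in> A}"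

definition factorization_semigroup ::
  "('a, 'b) monoid_scheme \<Rightarrow> 'a set \<Rightarrow> 'a list set set" where
  "factorization_semigroup G A = (lists A - {[]}) // word_cong A (hurwitz_rels G A)"

definition factorization_mult ::
  "('a, 'b) monoid_scheme \<Rightarrow> 'a set \<Rightarrow> 'a list set \<Rightarrow> 'a list set \<Rightarrow> 'a list set" where
  "factorization_mult G A = word_class_mult A (hurwitz_rels G A)"

definition word_prod :: "('a, 'b) monoid_scheme \<Rightarrow> 'a list \<Rightarrow> 'a" where
  "word_prod G w = foldr (\<otimes>\<^bsub>G\<^esub>) w \<one>\<^bsub>G\<^esub>"

text \<open>The common value of the product on all representatives of a class; see
  \<open>factorization_prod_class\<close>.\<close>

definition factorization_prod :: "('a, 'b) monoid_scheme \<Rightarrow> 'a list set \<Rightarrow> 'a" where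
  "factorization_prod G s = the_elem (word_prod G ` s)"

lemma (in group) word_prod_closed: "w \<in> lists (carrier G) \<Longrightarrow> word_prod G w \<in> carrier G"
  by (induction w) (auto simp: word_prod_def)

lemma (in group) word_prod_append:
  "u \<in> lists (carrier G) \<Longrightarrow> v \<in> lists (carrier G)
    \<Longrightarrow> word_prod G (u @ v) = word_prod G u \<otimes> word_prod G v"
proof (induction u)
  case Nil
  then show ?case using word_prod_closed[of v] by (simp add: word_prod_def)
next
  case (Cons x u)
  then show ?case
    using word_prod_closed[of u] word_prod_closed[of v] by (simp add: word_prod_def m_assoc)
qed

lemma (in group) word_prod_hurwitz:
  assumes "A \<subseteq> carrier G" "(u, v) \<in> word_cong A (hurwitz_rels G A)"
  shows "word_prod G u = word_prod G v"
  using assms(2)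
proof (induction rule: word_cong.induct)
  case (base u v)
  then consider x y where "x \<in> A" "y \<in> A" "u = [x, y]" "v = [y, inv y \<otimes> x \<otimes> y]"
    | x y where "x \<in> A" "y \<in> A" "u = [x, y]" "v = [x \<otimes> y \<otimes> inv x, x]"
    unfolding hurwitz_rels_def by blast
  then show ?case
  proof cases
    case 1
    then have xy: "x \<in> carrier G" "y \<in> carrier G" using assms(1) by auto
    have "y \<otimes> (inv y \<otimes> x \<otimes> y) = (y \<otimes> inv y) \<otimes> (x \<otimes> y)"
      using xy by (simp only: m_assoc inv_closed m_closed)
    then show ?thesis using 1 xy by (simp add: word_prod_def)
  next
    case 2
    then have xy: "x \<in> carrier G" "y \<in> carrier G" using assms(1) by auto
    have "(x \<otimes> y \<otimes> inv x) \<otimes> x = (x \<otimes> y) \<otimes> (inv x \<otimes> x)"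
      using xy by (simp only: m_assoc inv_closed m_closed)
    then show ?thesis using 2 xy by (simp add: word_prod_def)
  qed
next
  case (append u v u' v')
  then have "u \<in> lists (carrier G)" "v \<in> lists (carrier G)"
    "u' \<in> lists (carrier G)" "v' \<in> lists (carrier G)"
    using word_cong_lists assms(1) lists_mono by blast+
  with append show ?case by (simp add: word_prod_append)
qed auto

lemma (in group) factorization_prod_class:
  assumes "A \<subseteq> carrier G" "w \<in> lists A"
  shows "factorization_prod G (word_cong A (hurwitz_rels G A) `` {w}) = word_prod G w"
proof -
  have "word_prod G ` (word_cong A (hurwitz_rels G A) `` {w}) = {word_prod G w}"
    using word_prod_hurwitz[OF assms(1)] word_cong.refl[OF assms(2)] by (fastforce simp: image_iff)
  then show ?thesis by (simp add: factorization_prod_def)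
qed

lemma (in group) factorization_prod_mult:
  assumes "A \<subseteq> carrier G"
    and "s \<in> factorization_semigroup G A" "t \<in> factorization_semigroup G A"
  shows "factorization_mult G A s t \<in> factorization_semigroup G A"
    and "factorization_prod G (factorization_mult G A s t)
      = factorization_prod G s \<otimes> factorization_prod G t"
proof -
  obtain u v where *: "u \<in> lists A" "v \<in> lists A" "u \<noteq> []"
    "s = word_cong A (hurwitz_rels G A) `` {u}" "t = word_cong A (hurwitz_rels G A) `` {v}"
    using assms(2,3) by (auto simp: factorization_semigroup_def elim!: quotientE)
  have uv: "u @ v \<in> lists A" "u @ v \<in> lists A - {[]}" using * by simp_all
  have m: "factorization_mult G A s t = word_cong A (hurwitz_rels G A) `` {u @ v}"
    unfolding factorization_mult_def *(4,5) by (rule word_class_mult_class[OF *(1,2)])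
  show "factorization_mult G A s t \<in> factorization_semigroup G A"
    unfolding m factorization_semigroup_def by (rule quotientI[OF uv(2)])
  have "u \<in> lists (carrier G)" "v \<in> lists (carrier G)"
    using *(1,2) assms(1) lists_mono by blast+
  then show "factorization_prod G (factorization_mult G A s t)
      = factorization_prod G s \<otimes> factorization_prod G t"
    unfolding m factorization_prod_class[OF assms(1) uv(1)]
    unfolding *(4,5) factorization_prod_class[OF assms(1) *(1)] factorization_prod_class[OF assms(1) *(2)]
    by (rule word_prod_append)
qed

lemma (in group) conj_class_closed: "g \<in> carrier G \<Longrightarrow> conj_class G g \<subseteq> carrier G"
  by (auto simp: conj_class_def)

lemma (in group) conj_class_invariant:
  assumes "g \<in> carrier G" "h \<in> conj_class G g" "y \<in> carrier G"
  shows "y \<otimes> h \<otimes> inv y \<in> conj_class G g"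
proof -
  obtain x where x: "x \<in> carrier G" "h = x \<otimes> g \<otimes> inv x"
    using assms(2) by (auto simp: conj_class_def)
  have "y \<otimes> h \<otimes> inv y = (y \<otimes> x) \<otimes> g \<otimes> inv (y \<otimes> x)"
    using x assms by (simp add: m_assoc inv_mult_group)
  then show ?thesis using x assms(3) by (auto simp: conj_class_def)
qed

end

theory Submission
  imports Defs "HOL-Algebra.Sym_Groups"
begin

text \<open>Conjugating every letter of a factorization by a braid that commutes with its product gives
  another factorization of the same product. The example is of this kind. Write \<open>a\<close>, \<open>b\<close>, \<open>c\<close> for
  the standard generators, and put \<open>y = (a c) b (a c)\<^sup>-\<^sup>1\<close>. The braid \<open>b y = (b a c b) (a c)\<^sup>-\<^sup>1\<close> exchanges
  the pair of the first two strands with the pair of the last two, so conjugation by it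
  interchanges \<open>a\<close> and \<open>c\<close>, and its square commutes with \<open>a\<close> (\<open>braid_square_commute\<close>). Hence
  \<open>b \<cdot> y \<cdot> b \<cdot> y\<close> and its conjugate by \<open>a\<close> have the same product.

  Hurwitz moves preserve the subgroup generated by the letters, in particular the truth of
  \<open>all letters lie in H\<close> for a fixed subgroup \<open>H\<close> (\<open>word_cong_hurwitz_subgroup_iff\<close>). To tell
  the two words apart, let the braid group act on the three partitions of the four strands into two
  pairs (\<open>braid4_hom_sym3\<close>). There \<open>a\<close> and \<open>c\<close> act by the same transposition, so \<open>a c\<close> acts trivially
  and \<open>b\<close> and \<open>y\<close> act by one transposition, with a fixed point; the conjugate of \<open>b\<close> by \<open>a\<close>
  moves this point. The stabilizer of the point therefore contains all letters of the first word
  but not all letters of the second.\<close>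

section \<open>Conjugation and words in a group\<close>

lemma (in group) word_prod_conj:
  assumes "z \<in> carrier G" "w \<in> lists (carrier G)"
  shows "word_prod G (map (\<lambda>x. z \<otimes> x \<otimes> inv z) w) = z \<otimes> word_prod G w \<otimes> inv z"
  using assms(2)
proof (induction w)
  case Nil
  then show ?case using assms(1) by (simp add: word_prod_def)
next
  case (Cons x w)
  then have c: "x \<in> carrier G" "word_prod G w \<in> carrier G"
    using word_prod_closed by auto
  have "word_prod G (map (\<lambda>x. z \<otimes> x \<otimes> inv z) (x # w))
      = (z \<otimes> x \<otimes> inv z) \<otimes> (z \<otimes> word_prod G w \<otimes> inv z)"
    using Cons by (simp add: word_prod_def)
  also have "\<dots> = z \<otimes> x \<otimes> (inv z \<otimes> z) \<otimes> word_prod G w \<otimes> inv z"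
    using c assms(1) by (simp only: m_assoc m_closed inv_closed)
  also have "\<dots> = z \<otimes> word_prod G (x # w) \<otimes> inv z"
    using c assms(1) by (simp add: word_prod_def m_assoc)
  finally show ?case .
qed

lemma (in group) conj_eq_self:
  assumes "x \<in> carrier G" "y \<in> carrier G" "x \<otimes> y = y \<otimes> x"
  shows "x \<otimes> y \<otimes> inv x = y"
  using assms by (simp add: m_assoc)

lemma (in group) inv_commute:
  assumes "x \<in> carrier G" "y \<in> carrier G" "x \<otimes> y = y \<otimes> x"
  shows "inv y \<otimes> x = x \<otimes> inv y"
  using assms conj_eq_self[of y x] by (simp add: inv_solve_left' m_assoc)

lemma (in subgroup) conj_mem_iff:
  assumes "group G" "h \<in> H" "x \<in> carrier G"
  shows "h \<otimes> x \<otimes> inv h \<in> H \<longleftrightarrow> x \<in> H"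
proof
  interpret group G by fact
  have h: "h \<in> carrier G" using assms(2) by (rule mem_carrier)
  assume "h \<otimes> x \<otimes> inv h \<in> H"
  then have "inv h \<otimes> (h \<otimes> x \<otimes> inv h) \<otimes> h \<in> H"
    using assms(2) by simp
  also have "inv h \<otimes> (h \<otimes> x \<otimes> inv h) \<otimes> h = (inv h \<otimes> h) \<otimes> x \<otimes> (inv h \<otimes> h)"
    using h assms(3) by (simp only: m_assoc m_closed inv_closed)
  finally show "x \<in> H" using h assms(3) by simp
qed (use assms(2) in simp)

text \<open>A Hurwitz move replaces one letter by its conjugate under a neighbouring letter that stays in
  the word, so it cannot change the subgroup that the letters generate.\<close>

lemma (in group) word_cong_hurwitz_subgroup_iff:
  assumes A: "A \<subseteq> carrier G" and H: "subgroup H G"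
    and "(u, v) \<in> word_cong A (hurwitz_rels G A)"
  shows "set u \<subseteq> H \<longleftrightarrow> set v \<subseteq> H"
  using assms(3)
proof (induction rule: word_cong.induct)
  case (base u v)
  then consider x y where "x \<in> A" "y \<in> A" "u = [x, y]" "v = [y, inv y \<otimes> x \<otimes> y]"
    | x y where "x \<in> A" "y \<in> A" "u = [x, y]" "v = [x \<otimes> y \<otimes> inv x, x]"
    unfolding hurwitz_rels_def by blast
  then show ?case
  proof cases
    case 1
    then have "x \<in> carrier G" "y \<in> carrier G" using A by auto
    then have "inv y \<otimes> x \<otimes> y \<in> H \<longleftrightarrow> x \<in> H" if "y \<in> H"
      using subgroup.conj_mem_iff[OF H is_group, of "inv y" x] subgroup.m_inv_closed[OF H that]
      by simp
    then show ?thesis using 1 by auto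
  next
    case 2
    then have "x \<in> carrier G" "y \<in> carrier G" using A by auto
    then show ?thesis using 2 subgroup.conj_mem_iff[OF H is_group, of x y] by auto
  qed
qed auto

section \<open>Homomorphisms out of presented groups and braid groups\<close>

definition letter_value :: "('b, 'c) monoid_scheme \<Rightarrow> ('a \<Rightarrow> 'b) \<Rightarrow> 'a \<times> bool \<Rightarrow> 'b" where
  "letter_value G f p = (if snd p then f (fst p) else inv\<^bsub>G\<^esub> f (fst p))"

text \<open>This is the universal property of a presentation: evaluation of words respects the relators,
  hence descends to classes, and it turns concatenation into multiplication.\<close>

lemma (in group) presented_group_hom_exists:
  fixes X :: "'x set"
  assumes f: "f \<in> X \<rightarrow> carrier G"
    and rels: "\<And>u v. (u, v) \<in> R \<Longrightarrow> u \<in> lists (X \<times> UNIV) \<Longrightarrow> v \<in> lists (X \<times> UNIV) \<Longrightarrow>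
      word_prod G (map (letter_value G f) u) = word_prod G (map (letter_value G f) v)"
  obtains h where "h \<in> hom (presented_group X R) G"
    and "\<And>w. w \<in> lists (X \<times> UNIV) \<Longrightarrow>
      h (word_cong (X \<times> UNIV) (presentation_rels X R) `` {w})
        = word_prod G (map (letter_value G f) w)"
proof -
  let ?L = "lists (X \<times> (UNIV :: bool set))"
  let ?E = "word_cong (X \<times> UNIV) (presentation_rels X R)"
  define ev where "ev w = word_prod G (map (letter_value G f) w)" for w
  have letters: "map (letter_value G f) w \<in> lists (carrier G)" if "w \<in> ?L" for w
    using that f by (induction w) (auto simp: letter_value_def)
  have ev_append: "ev (u @ v) = ev u \<otimes> ev v" if "u \<in> ?L" "v \<in> ?L" for u v
    using letters that by (simp add: ev_def word_prod_append)
  have ev_cong: "ev u = ev v" if "(u, v) \<in> ?E" for u v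
    using that
  proof (induction rule: word_cong.induct)
    case (base u v)
    from base(1) consider x b where "x \<in> X" "u = [(x, b), (x, \<not> b)]" "v = []" | "(u, v) \<in> R"
      unfolding presentation_rels_def by blast
    then show ?case
    proof cases
      case 1
      then have "f x \<in> carrier G" using f by blast
      then show ?thesis using 1 by (cases b) (simp_all add: ev_def word_prod_def letter_value_def)
    next
      case 2
      then show ?thesis using base rels by (simp add: ev_def)
    qed
  next
    case (append u v u' v')
    then have "u \<in> ?L" "v \<in> ?L" "u' \<in> ?L" "v' \<in> ?L"
      using word_cong_lists by blast+
    with append show ?case by (simp only: ev_append)
  qed auto
  define h where "h C = the_elem (ev ` C)" for C
  have h_class: "h (?E `` {w}) = ev w" if "w \<in> ?L" for w
  proof -
    have "ev ` (?E `` {w}) = {ev w}"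
      using ev_cong word_cong.refl[OF that] by (fastforce simp: image_iff)
    then show ?thesis by (simp add: h_def)
  qed
  have "h \<in> hom (presented_group X R) G"
  proof (rule homI)
    fix C assume "C \<in> carrier (presented_group X R)"
    then obtain u where "u \<in> ?L" "C = ?E `` {u}"
      by (auto simp: presented_group_def elim!: quotientE)
    then show "h C \<in> carrier G"
      using word_prod_closed[OF letters] by (simp only: h_class) (simp add: ev_def)
  next
    fix C D assume "C \<in> carrier (presented_group X R)" "D \<in> carrier (presented_group X R)"
    then obtain u v where uv: "u \<in> ?L" "C = ?E `` {u}" "v \<in> ?L" "D = ?E `` {v}"
      by (auto simp: presented_group_def elim!: quotientE)
    have "u @ v \<in> ?L" using uv by simp
    then show "h (C \<otimes>\<^bsub>presented_group X R\<^esub> D) = h C \<otimes> h D"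
      using uv by (simp add: presented_group_def word_class_mult_class h_class ev_append del: append_in_lists_conv)
  qed
  then show thesis using that h_class by (simp add: ev_def)
qed

lemma braid_gen_braid:
  assumes "1 \<le> i" "i + 1 < n"
  shows "braid_gen n i \<otimes>\<^bsub>braid_group n\<^esub> braid_gen n (i + 1) \<otimes>\<^bsub>braid_group n\<^esub> braid_gen n i
    = braid_gen n (i + 1) \<otimes>\<^bsub>braid_group n\<^esub> braid_gen n i \<otimes>\<^bsub>braid_group n\<^esub> braid_gen n (i + 1)"
proof -
  have "([(i, True), (i + 1, True), (i, True)], [(i + 1, True), (i, True), (i + 1, True)])
      \<in> word_cong ({1..<n} \<times> UNIV) (presentation_rels {1..<n} (braid_rels n))"
    by (rule word_cong.base) (use assms in \<open>auto simp: presentation_rels_def braid_rels_def\<close>)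
  from word_class_eqI[OF this] show ?thesis
    using assms by (simp add: braid_gen_def braid_group_def presented_group_def word_class_mult_class)
qed

lemma braid_gen_commute:
  assumes "1 \<le> i" "i + 2 \<le> j" "j < n"
  shows "braid_gen n i \<otimes>\<^bsub>braid_group n\<^esub> braid_gen n j
    = braid_gen n j \<otimes>\<^bsub>braid_group n\<^esub> braid_gen n i"
proof -
  have "([(i, True), (j, True)], [(j, True), (i, True)])
      \<in> word_cong ({1..<n} \<times> UNIV) (presentation_rels {1..<n} (braid_rels n))"
    by (rule word_cong.base) (use assms in \<open>auto simp: presentation_rels_def braid_rels_def\<close>)
  from word_class_eqI[OF this] show ?thesis
    using assms by (simp add: braid_gen_def braid_group_def presented_group_def word_class_mult_class)
qed

lemma (in group) braid_group_hom_exists: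
  assumes f: "f \<in> {1..<n} \<rightarrow> carrier G"
    and braid: "\<And>i. 1 \<le> i \<Longrightarrow> i + 1 < n \<Longrightarrow>
      f i \<otimes> f (i + 1) \<otimes> f i = f (i + 1) \<otimes> f i \<otimes> f (i + 1)"
    and commute: "\<And>i j. 1 \<le> i \<Longrightarrow> i + 2 \<le> j \<Longrightarrow> j < n \<Longrightarrow> f i \<otimes> f j = f j \<otimes> f i"
  obtains h where "h \<in> hom (braid_group n) G"
    and "\<And>i. 1 \<le> i \<Longrightarrow> i < n \<Longrightarrow> h (braid_gen n i) = f i"
proof -
  have fc: "f i \<in> carrier G" if "1 \<le> i" "i < n" for i using f that by auto
  have "word_prod G (map (letter_value G f) u) = word_prod G (map (letter_value G f) v)"
    if uv: "(u, v) \<in> braid_rels n" for u v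
    using uv[unfolded braid_rels_def]
  proof (elim UnE CollectE exE conjE)
    fix i assume *: "(u, v) = ([(i, True), (i + 1, True), (i, True)],
        [(i + 1, True), (i, True), (i + 1, True)])" "1 \<le> i" "i + 1 < n"
    then show ?thesis
      using braid[OF *(2,3)] fc[of i] fc[of "i + 1"]
      by (simp add: word_prod_def letter_value_def m_assoc)
  next
    fix i j assume *: "(u, v) = ([(i, True), (j, True)], [(j, True), (i, True)])"
      "1 \<le> i" "i + 2 \<le> j" "j < n"
    then show ?thesis
      using commute[OF *(2-4)] fc[of i] fc[of j] by (simp add: word_prod_def letter_value_def)
  qed
  then obtain h where "h \<in> hom (presented_group {1..<n} (braid_rels n)) G"
    and h: "\<And>w. w \<in> lists ({1..<n} \<times> UNIV) \<Longrightarrow>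
      h (word_cong ({1..<n} \<times> UNIV) (presentation_rels {1..<n} (braid_rels n)) `` {w})
        = word_prod G (map (letter_value G f) w)"
    using presented_group_hom_exists[OF f, of "braid_rels n"] by blast
  moreover have "h (braid_gen n i) = f i" if "1 \<le> i" "i < n" for i
    using h[of "[(i, True)]"] that fc[OF that]
    by (simp add: braid_gen_def word_prod_def letter_value_def)
  ultimately show thesis using that by (simp add: braid_group_def)
qed

section \<open>The action of four-strand braids on three points\<close>

text \<open>Permuting the strands, a braid permutes the three ways to split the four strands into two
  pairs. A generator fixes the splitting in which the two strands that it exchanges are paired
  with each other; the first and the third generator fix the same splitting, so their images
  coincide. In the numbering used here this splitting is \<open>3\<close>, and the second generator fixes \<open>1\<close>.\<close>

lemma braid4_hom_sym3:
  obtains h where "group_hom (braid_group 4) (sym_group 3) h"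
    and "h (braid_gen 4 1) = transpose 1 2" "h (braid_gen 4 2) = transpose 2 3"
    and "h (braid_gen 4 3) = transpose 1 2"
proof -
  define f :: "nat \<Rightarrow> nat \<Rightarrow> nat" where "f i = (if i = 2 then transpose 2 3 else transpose 1 2)" for i
  interpret S: group "sym_group 3" by (rule sym_group_is_group)
  have f: "f \<in> {1..<4} \<rightarrow> carrier (sym_group 3)"
    by (auto simp: f_def sym_group_def intro!: permutes_swap_id)
  have braid: "f i \<otimes>\<^bsub>sym_group 3\<^esub> f (i + 1) \<otimes>\<^bsub>sym_group 3\<^esub> f i
      = f (i + 1) \<otimes>\<^bsub>sym_group 3\<^esub> f i \<otimes>\<^bsub>sym_group 3\<^esub> f (i + 1)" if "1 \<le> i" "i + 1 < 4" for i
  proof -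
    have "i = 1 \<or> i = 2" using that by auto
    then show ?thesis by (auto simp: f_def sym_group_def fun_eq_iff transpose_def)
  qed
  have commute: "f i \<otimes>\<^bsub>sym_group 3\<^esub> f j = f j \<otimes>\<^bsub>sym_group 3\<^esub> f i"
    if "1 \<le> i" "i + 2 \<le> j" "j < 4" for i j
  proof -
    have "i = 1" "j = 3" using that by auto
    then show ?thesis by (simp add: f_def)
  qed
  obtain h where "h \<in> hom (braid_group 4) (sym_group 3)"
    and h: "\<And>i. 1 \<le> i \<Longrightarrow> i < 4 \<Longrightarrow> h (braid_gen 4 i) = f i"
    using S.braid_group_hom_exists[OF f braid commute] by blast
  then show thesis
    using that[of h] group_braid_group S.is_group h[of 1] h[of 2] h[of 3]
    by (simp add: group_hom_def group_hom_axioms_def f_def)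
qed

lemma subgroup_stabilizer_sym_group:
  assumes "group_hom G (sym_group n) h"
  shows "subgroup {g \<in> carrier G. h g p = p} G"
proof -
  interpret group_hom G "sym_group n" h by fact
  have fix_inv: "h (inv\<^bsub>G\<^esub> g) p = p" if "g \<in> carrier G" "h g p = p" for g
  proof -
    have "h (inv\<^bsub>G\<^esub> g) \<circ> h g = id"
      using that hom_mult[of "inv\<^bsub>G\<^esub> g" g] G.l_inv[of g] hom_one G.inv_closed
      by (simp add: sym_group_mult sym_group_one del: hom_mult hom_inv)
    then show ?thesis using that(2) by (metis comp_apply id_apply)
  qed
  show ?thesis
    by (rule G.subgroupI) (use fix_inv G.one_closed in \<open>auto simp: sym_group_mult sym_group_one\<close>)
qed

section \<open>Two factorizations of one braid\<close>

text \<open>The braid \<open>t = b a c b\<close> crosses the band of the first two strands with the band of the last two: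
  \<open>a t = t c\<close> and \<open>c t = t a\<close>. Since \<open>a c\<close> commutes with \<open>a\<close> and \<open>c\<close>, the braid \<open>g = t (a c)\<^sup>-\<^sup>1\<close> also
  interchanges \<open>a\<close> and \<open>c\<close> by conjugation, and its square fixes them.\<close>

lemma (in group) braid_square_commute:
  assumes "a \<in> carrier G" "b \<in> carrier G" "c \<in> carrier G"
    and aba: "a \<otimes> b \<otimes> a = b \<otimes> a \<otimes> b" and bcb: "b \<otimes> c \<otimes> b = c \<otimes> b \<otimes> c" and ac: "a \<otimes> c = c \<otimes> a"
  defines "g \<equiv> b \<otimes> ((a \<otimes> c) \<otimes> b \<otimes> inv (a \<otimes> c))"
  shows "a \<otimes> (g \<otimes> g) = (g \<otimes> g) \<otimes> a"
proof -
  define t where "t = b \<otimes> (a \<otimes> c) \<otimes> b"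
  define z where "z = inv (a \<otimes> c)"
  note cl = assms(1-3)
  have t: "t \<in> carrier G" and z: "z \<in> carrier G" using cl by (auto simp: t_def z_def)
  have g: "g = t \<otimes> z" using cl by (simp add: g_def t_def z_def m_assoc)
  have at: "a \<otimes> t = t \<otimes> c"
  proof -
    have "a \<otimes> t = (a \<otimes> b \<otimes> a) \<otimes> (c \<otimes> b)" using cl by (simp add: t_def m_assoc)
    also have "\<dots> = b \<otimes> a \<otimes> (b \<otimes> c \<otimes> b)" using cl by (simp add: aba m_assoc)
    also have "\<dots> = t \<otimes> c" using cl by (simp add: bcb t_def m_assoc)
    finally show ?thesis .
  qed
  have ct: "c \<otimes> t = t \<otimes> a"
  proof -
    have "c \<otimes> t = (c \<otimes> b \<otimes> c) \<otimes> (a \<otimes> b)" using cl by (simp add: t_def ac m_assoc)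
    also have "\<dots> = b \<otimes> c \<otimes> (b \<otimes> a \<otimes> b)" using cl by (simp add: bcb[symmetric] m_assoc)
    also have "\<dots> = b \<otimes> (c \<otimes> a) \<otimes> b \<otimes> a" using cl by (simp add: aba[symmetric] m_assoc)
    also have "\<dots> = t \<otimes> a" by (simp add: t_def ac)
    finally show ?thesis .
  qed
  have "a \<otimes> (a \<otimes> c) = (a \<otimes> c) \<otimes> a" "c \<otimes> (a \<otimes> c) = (a \<otimes> c) \<otimes> c"
    using cl by (simp_all add: m_assoc ac) (metis ac m_assoc)+
  then have az: "z \<otimes> a = a \<otimes> z" and cz: "z \<otimes> c = c \<otimes> z"
    unfolding z_def using cl by (simp_all add: inv_commute)
  have "a \<otimes> (g \<otimes> g) = (a \<otimes> t) \<otimes> z \<otimes> t \<otimes> z" using cl t z by (simp add: g m_assoc)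
  also have "\<dots> = t \<otimes> (z \<otimes> c) \<otimes> t \<otimes> z" using cl t z by (simp add: at cz m_assoc)
  also have "\<dots> = t \<otimes> z \<otimes> (c \<otimes> t) \<otimes> z" using cl t z by (simp add: m_assoc)
  also have "\<dots> = t \<otimes> z \<otimes> t \<otimes> (z \<otimes> a)" using cl t z by (simp add: ct az m_assoc)
  also have "\<dots> = (g \<otimes> g) \<otimes> a" using cl t z by (simp add: g m_assoc)
  finally show ?thesis .
qed

theorem proposition5p1:
  "\<exists>s\<^sub>1 \<in> factorization_semigroup (braid_group 4) (half_twists 4).
   \<exists>s\<^sub>2 \<in> factorization_semigroup (braid_group 4) (half_twists 4).
     s\<^sub>1 \<noteq> s\<^sub>2 \<and>
     factorization_prod (braid_group 4) s\<^sub>1 = factorization_prod (braid_group 4) s\<^sub>2 \<and>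
     factorization_prod (braid_group 4) s\<^sub>2 \<in> carrier (braid_group 4)"
proof -
  let ?G = "braid_group 4" and ?A = "half_twists 4"
  let ?E = "word_cong ?A (hurwitz_rels ?G ?A)"
  interpret G: group ?G by (rule group_braid_group)
  obtain h where "group_hom ?G (sym_group 3) h"
    and h: "h (braid_gen 4 1) = transpose 1 2" "h (braid_gen 4 2) = transpose 2 3"
      "h (braid_gen 4 3) = transpose 1 2"
    by (rule braid4_hom_sym3)
  then interpret h: group_hom ?G "sym_group 3" h by simp
  define a where "a = braid_gen 4 1"
  define b where "b = braid_gen 4 2"
  define c where "c = braid_gen 4 3"
  note h = h[folded a_def b_def c_def]
  have cl: "a \<in> carrier ?G" "b \<in> carrier ?G" "c \<in> carrier ?G"
    by (simp_all add: a_def b_def c_def braid_gen_closed)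
  have aba: "a \<otimes>\<^bsub>?G\<^esub> b \<otimes>\<^bsub>?G\<^esub> a = b \<otimes>\<^bsub>?G\<^esub> a \<otimes>\<^bsub>?G\<^esub> b"
    and bcb: "b \<otimes>\<^bsub>?G\<^esub> c \<otimes>\<^bsub>?G\<^esub> b = c \<otimes>\<^bsub>?G\<^esub> b \<otimes>\<^bsub>?G\<^esub> c"
    using braid_gen_braid[of 1 4] braid_gen_braid[of 2 4] by (simp_all add: a_def b_def c_def numeral_eq_Suc)
  have ac: "a \<otimes>\<^bsub>?G\<^esub> c = c \<otimes>\<^bsub>?G\<^esub> a"
    using braid_gen_commute[of 1 3 4] by (simp add: a_def c_def)
  have A: "?A \<subseteq> carrier ?G"
    unfolding half_twists_def using G.conj_class_closed cl(1) a_def by simp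
  have A_conj: "x \<otimes>\<^bsub>?G\<^esub> t \<otimes>\<^bsub>?G\<^esub> inv\<^bsub>?G\<^esub> x \<in> ?A" if "t \<in> ?A" "x \<in> carrier ?G" for x t
    using that G.conj_class_invariant cl(1) by (simp add: half_twists_def a_def)
  \<comment> \<open>The braid relation says that \<open>a b\<close> conjugates \<open>a\<close> to \<open>b\<close>.\<close>
  have bA: "b \<in> ?A"
  proof -
    have "(a \<otimes>\<^bsub>?G\<^esub> b) \<otimes>\<^bsub>?G\<^esub> a \<otimes>\<^bsub>?G\<^esub> inv\<^bsub>?G\<^esub> (a \<otimes>\<^bsub>?G\<^esub> b) = b"
      using cl by (simp add: aba G.inv_solve_right' G.m_assoc)
    then show ?thesis
      using cl unfolding half_twists_def conj_class_def a_def by (metis (mono_tags, lifting) G.m_closed mem_Collect_eq)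
  qed
  define y where "y = (a \<otimes>\<^bsub>?G\<^esub> c) \<otimes>\<^bsub>?G\<^esub> b \<otimes>\<^bsub>?G\<^esub> inv\<^bsub>?G\<^esub> (a \<otimes>\<^bsub>?G\<^esub> c)"
  have yA: "y \<in> ?A" unfolding y_def using A_conj bA cl by simp
  have y: "y \<in> carrier ?G" using A yA by blast
  define w where "w = [b, y, b, y]"
  define w' where "w' = map (\<lambda>x. a \<otimes>\<^bsub>?G\<^esub> x \<otimes>\<^bsub>?G\<^esub> inv\<^bsub>?G\<^esub> a) w"
  have w: "w \<in> lists ?A" using bA yA by (simp add: w_def)
  have w': "w' \<in> lists ?A" using A_conj cl(1) bA yA by (simp add: w'_def w_def)
  have wc: "w \<in> lists (carrier ?G)" using w A by auto
  have "word_prod ?G w = (b \<otimes>\<^bsub>?G\<^esub> y) \<otimes>\<^bsub>?G\<^esub> (b \<otimes>\<^bsub>?G\<^esub> y)"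
    using cl y by (simp add: w_def word_prod_def G.m_assoc)
  then have "a \<otimes>\<^bsub>?G\<^esub> word_prod ?G w = word_prod ?G w \<otimes>\<^bsub>?G\<^esub> a"
    using G.braid_square_commute[OF cl aba bcb ac] by (simp add: y_def)
  then have prod: "word_prod ?G w' = word_prod ?G w"
    using G.word_prod_conj[OF cl(1) wc] G.conj_eq_self[OF cl(1) G.word_prod_closed[OF wc]]
    by (simp add: w'_def)
  \<comment> \<open>The point \<open>1\<close> is the one fixed by the image of \<open>b\<close>.\<close>
  define H where "H = {g \<in> carrier ?G. h g 1 = 1}"
  have H: "subgroup H ?G"
    unfolding H_def by (rule subgroup_stabilizer_sym_group) (rule h.group_hom_axioms)
  have "h (a \<otimes>\<^bsub>?G\<^esub> c) = id"
    using cl h by (simp add: sym_group_mult)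
  then have acH: "a \<otimes>\<^bsub>?G\<^esub> c \<in> H" using cl by (simp add: H_def)
  have bH: "b \<in> H" using cl h by (simp add: H_def transpose_def)
  have "y \<in> H" unfolding y_def
    using subgroup.conj_mem_iff[OF H G.is_group acH cl(2)] bH by simp
  then have wH: "set w \<subseteq> H" using bH by (simp add: w_def)
  \<comment> \<open>The first letter of \<open>w'\<close> acts as the transposition of \<open>1\<close> and \<open>3\<close>.\<close>
  have w'H: "\<not> set w' \<subseteq> H"
  proof
    assume "set w' \<subseteq> H"
    then have "h (a \<otimes>\<^bsub>?G\<^esub> b \<otimes>\<^bsub>?G\<^esub> inv\<^bsub>?G\<^esub> a) 1 = 1"
      by (simp add: w'_def w_def H_def)
    moreover have "h (a \<otimes>\<^bsub>?G\<^esub> b \<otimes>\<^bsub>?G\<^esub> inv\<^bsub>?G\<^esub> a) \<circ> h a = h a \<circ> h b"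
      using cl h.hom_mult[of "a \<otimes>\<^bsub>?G\<^esub> b \<otimes>\<^bsub>?G\<^esub> inv\<^bsub>?G\<^esub> a" a] h.hom_mult[of a b]
      by (simp add: sym_group_mult G.m_assoc)
    ultimately have "h a (h b 2) = 1"
      using h(1) by (metis comp_apply transpose_apply_second)
    then show False using h by (simp add: transpose_def)
  qed
  let ?s = "?E `` {w}" and ?s' = "?E `` {w'}"
  have "?s \<noteq> ?s'"
  proof
    assume "?s = ?s'"
    then have "(w, w') \<in> ?E" using eq_equiv_class[OF _ equiv_word_cong w'] by blast
    then show False using G.word_cong_hurwitz_subgroup_iff[OF A H] wH w'H by blast
  qed
  moreover have "?s \<in> factorization_semigroup ?G ?A" "?s' \<in> factorization_semigroup ?G ?A"
    using w w' unfolding factorization_semigroup_def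
    by (auto intro!: quotientI simp: w_def w'_def)
  moreover have "factorization_prod ?G ?s = word_prod ?G w" "factorization_prod ?G ?s' = word_prod ?G w"
    using G.factorization_prod_class[OF A w] G.factorization_prod_class[OF A w'] prod by simp_all
  ultimately show ?thesis
    using G.word_prod_closed[OF wc] by (metis (no_types, lifting))
qed

end
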